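(* Let $p>0$ and suppose the delay $\mathbf{j}$ follows the Poisson distribution with parameter $p$, i.e. $q_t=\mathrm{Prob}(\mathbf{j}=t)=\frac{p^te^{-p}}{t!}$ for $t=0,1,\dots$. Then for any $\rho>1$, $$\mathbb{E}[\mathbf{j}]=p,\qquad \mathbb{E}[\mathbf{j}^2]=p(p+1),\qquad \mathbb{E}[\rho^{\mathbf{j}}]=e^{p(\rho-1)},\qquad \mathbb{E}[\mathbf{j}\rho^{\mathbf{j}}]=\rho p\,e^{p(\rho-1)},$$ $$\gamma_{\rho,1}=\frac{e^{p(\sqrt{\rho}-1)}-1}{\sqrt{\rho}-1},\qquad \gamma_{\rho,2}=\Big(\frac{\rho p\,e^{p(\rho-1)}-p}{1-\rho^{-1}}\Big)^{1/2}.$$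
   Context: The quantities $\gamma_{\rho,1}$ and $\gamma_{\rho,2}$ are defined by $$\gamma_{\rho,1}=\sum_{t=1}^\infty q_t\frac{\rho^{t/2}-1}{\rho^{1/2}-1},\qquad \gamma_{\rho,2}=\Big(\sum_{t=1}^\infty q_t\,t\,\frac{\rho^t-1}{1-\rho^{-1}}\Big)^{1/2}.$$ (In the paper, $p+1$ is the number of processors and $\mathbf{j}$ has the common distribution of the delays $j_k$.) *)

theory Defs
  imports "HOL-Probability.Probability"
begin

text \<open>
  Here \<open>q\<close> is the probability mass function of the delay. All terms are nonnegative for
  \<open>\<rho> > 1\<close>, so the unordered sums coincide with the ordered series. A divergent
  \<^const>\<open>infsum\<close> equals \<open>0\<close>, so an identity with nonzero right-hand side also
  says that the series converges.
\<close>

definition gamma1 :: "(nat \<Rightarrow> real) \<Rightarrow> real \<Rightarrow> real" where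
  "gamma1 q \<rho> =
     (\<Sum>\<^sub>\<infinity>t\<in>{1..}. q t * ((\<rho> powr (real t / 2) - 1) / (\<rho> powr (1 / 2) - 1)))"

definition gamma2 :: "(nat \<Rightarrow> real) \<Rightarrow> real \<Rightarrow> real" where
  "gamma2 q \<rho> =
     sqrt (\<Sum>\<^sub>\<infinity>t\<in>{1..}. q t * real t * ((\<rho> ^ t - 1) / (1 - inverse \<rho>)))"

end

theory Submission
  imports Defs
begin

text \<open>
  Every quantity in the theorem is a sum \<open>\<Sum>t. w t * f t\<close> with the Poisson weights
  \<open>w t = p ^ t / fact t * exp (- p)\<close> and a nonnegative \<open>f\<close>. Nonnegativity lets one ordered
  series serve as an expectation and as an unordered sum alike
  (\<open>expectation_pmf_nat\<close> and \<open>sums_nonneg_imp_has_sum\<close>), so it suffices to evaluate series.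

  Two facts do that. The exponential series gives the generating function
  \<open>\<Sum>t. w t * z ^ t = exp (p * (z - 1))\<close> (\<open>poisson_generating_function\<close>), and the recursion
  \<open>(t + 1) * w (t + 1) = p * w t\<close> removes a factor \<open>t\<close> from the summand at the price of a
  factor \<open>p\<close> and an index shift (\<open>poisson_sums_shift\<close>). The values at \<open>z = 1\<close> and \<open>z = \<rho>\<close>, with
  at most two shifts, give the four expectations. Since the terms with \<open>t = 0\<close> vanish,
  \<open>\<gamma>\<^sub>1\<close> is the difference of the generating function at \<open>z = sqrt \<rho>\<close> and at \<open>z = 1\<close>, divided by
  \<open>sqrt \<rho> - 1\<close>, and \<open>\<gamma>\<^sub>2\<^sup>2\<close> is the difference of the first moments weighted by \<open>\<rho> ^ t\<close> and by
  \<open>1\<close>, divided by \<open>1 - inverse \<rho>\<close>.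
\<close>

lemma expectation_pmf_nat:
  fixes P :: "nat pmf" and f :: "nat \<Rightarrow> real"
  assumes "\<And>t. f t \<ge> 0" and "(\<lambda>t. pmf P t * f t) sums S"
  shows "measure_pmf.expectation P f = S"
proof -
  have "summable (\<lambda>t. norm (pmf P t * f t))"
    using assms by (simp add: sums_iff)
  then have "integrable (count_space UNIV) (\<lambda>t. pmf P t * f t)"
    by (simp add: integrable_count_space_nat_iff)
  then have "(\<integral>t. pmf P t * f t \<partial>count_space UNIV) = S"
    using assms(2) sums_integral_count_space_nat sums_unique2 by blast
  then show ?thesis
    by (simp add: pmf_expectation_eq_infsetsum infsetsum_def)
qed

lemma infsum_drop_zero:
  fixes f :: "nat \<Rightarrow> real"
  assumes "f 0 = 0" and "\<And>t. f t \<ge> 0" and "f sums S"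
  shows "(\<Sum>\<^sub>\<infinity>t\<in>{1..}. f t) = S"
proof -
  have "(f has_sum S) UNIV"
    using assms by (intro sums_nonneg_imp_has_sum) auto
  moreover have "infsum f {1..} = infsum f UNIV"
    using assms(1) by (intro infsum_cong_neutral) (auto simp: not_less_eq_eq)
  ultimately show ?thesis
    by (simp add: infsumI)
qed

lemma poisson_generating_function:
  fixes p z :: real
  assumes "p > 0"
  shows "(\<lambda>t. pmf (poisson_pmf p) t * z ^ t) sums exp (p * (z - 1))"
proof -
  have "(\<lambda>t. exp (- p) * ((p * z) ^ t /\<^sub>R fact t)) sums (exp (- p) * exp (p * z))"
    by (intro sums_mult exp_converges)
  then show ?thesis
    using assms by (simp add: mult_exp_exp algebra_simps power_mult_distrib divide_inverse)
qed

text \<open>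
  This is the identity \<open>E[j * g j] = p * E[g (j + 1)]\<close> that characterises the Poisson
  distribution; it follows term by term from \<open>(t + 1) * w (t + 1) = p * w t\<close>.
\<close>

lemma poisson_sums_shift:
  fixes p :: real and g :: "nat \<Rightarrow> real"
  assumes "p > 0" and "(\<lambda>t. pmf (poisson_pmf p) t * g (Suc t)) sums S"
  shows "(\<lambda>t. pmf (poisson_pmf p) t * (real t * g t)) sums (p * S)"
proof -
  have "pmf (poisson_pmf p) (Suc t) * (real (Suc t) * g (Suc t))
      = p * (pmf (poisson_pmf p) t * g (Suc t))" for t
    using assms(1) by (simp add: field_simps del: of_nat_Suc)
  then have "(\<lambda>t. pmf (poisson_pmf p) (Suc t) * (real (Suc t) * g (Suc t))) sums (p * S)"
    using sums_mult[OF assms(2), of p] by (simp only:)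
  from sums_Suc[OF this] show ?thesis
    by simp
qed

lemma poisson_weighted_first_moment:
  fixes p z :: real
  assumes "p > 0"
  shows "(\<lambda>t. pmf (poisson_pmf p) t * (real t * z ^ t)) sums (z * p * exp (p * (z - 1)))"
proof -
  have "(\<lambda>t. pmf (poisson_pmf p) t * z ^ Suc t) sums (z * exp (p * (z - 1)))"
    using sums_mult[OF poisson_generating_function[OF assms], of z z] by (simp add: ac_simps)
  from poisson_sums_shift[OF assms this] show ?thesis
    by (simp add: ac_simps)
qed

lemma poisson_second_moment:
  fixes p :: real
  assumes "p > 0"
  shows "(\<lambda>t. pmf (poisson_pmf p) t * (real t)\<^sup>2) sums (p * (p + 1))"
proof -
  have "(\<lambda>t. pmf (poisson_pmf p) t * (real t * 1 ^ t) + pmf (poisson_pmf p) t * 1 ^ t)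
      sums (1 * p * exp (p * (1 - 1)) + exp (p * (1 - 1)))"
    by (intro sums_add poisson_weighted_first_moment poisson_generating_function assms)
  then have "(\<lambda>t. pmf (poisson_pmf p) t * real (Suc t)) sums (p + 1)"
    by (simp add: algebra_simps)
  from poisson_sums_shift[OF assms this] show ?thesis
    by (simp add: power2_eq_square)
qed

theorem proposition1:
  fixes M :: "'a measure" and j :: "'a \<Rightarrow> nat" and q :: "nat \<Rightarrow> real" and p \<rho> :: real
  assumes "prob_space M"
    and "p > 0"
    and "j \<in> measurable M (count_space UNIV)"
    and "distr M (count_space UNIV) j = measure_pmf (poisson_pmf p)"
    and "\<And>t. q t = measure M {\<omega> \<in> space M. j \<omega> = t}"
    and "\<rho> > 1"
  shows "prob_space.expectation M (\<lambda>\<omega>. real (j \<omega>)) = p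
    \<and> prob_space.expectation M (\<lambda>\<omega>. real (j \<omega>) ^ 2) = p * (p + 1)
    \<and> prob_space.expectation M (\<lambda>\<omega>. \<rho> ^ j \<omega>) = exp (p * (\<rho> - 1))
    \<and> prob_space.expectation M (\<lambda>\<omega>. real (j \<omega>) * \<rho> ^ j \<omega>) = \<rho> * p * exp (p * (\<rho> - 1))
    \<and> gamma1 q \<rho> = (exp (p * (sqrt \<rho> - 1)) - 1) / (sqrt \<rho> - 1)
    \<and> gamma2 q \<rho> = sqrt ((\<rho> * p * exp (p * (\<rho> - 1)) - p) / (1 - inverse \<rho>))"
proof -
  note p = assms(2) and rho = assms(6)
  let ?w = "pmf (poisson_pmf p)"
  have expectation: "prob_space.expectation M (\<lambda>\<omega>. f (j \<omega>)) = S"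
    if "\<And>t. f t \<ge> 0" "(\<lambda>t. ?w t * f t) sums S" for f :: "nat \<Rightarrow> real" and S
  proof -
    have "prob_space.expectation M (\<lambda>\<omega>. f (j \<omega>)) = measure_pmf.expectation (poisson_pmf p) f"
      using integral_distr[OF assms(3), of f] assms(4) by simp
    then show ?thesis
      using expectation_pmf_nat[OF that] by simp
  qed
  have q: "q t = ?w t" for t
  proof -
    have "?w t = measure (distr M (count_space UNIV) j) {t}"
      unfolding assms(4) by (simp only: pmf.rep_eq)
    also have "\<dots> = measure M (j -` {t} \<inter> space M)"
      using assms(3) by (intro measure_distr) auto
    also have "j -` {t} \<inter> space M = {\<omega> \<in> space M. j \<omega> = t}"
      by auto
    finally show ?thesis
      using assms(5) by simp
  qed
  have total: "?w sums 1"
    using poisson_generating_function[OF p, of 1] by simp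
  have mean: "(\<lambda>t. ?w t * real t) sums p"
    using poisson_weighted_first_moment[OF p, of 1] by simp
  have "gamma1 q \<rho> = (exp (p * (sqrt \<rho> - 1)) - 1) / (sqrt \<rho> - 1)"
  proof -
    have root: "\<rho> powr (real t / 2) = sqrt \<rho> ^ t" for t
      using rho by (simp add: powr_half_sqrt[symmetric] powr_power)
    have "(\<lambda>t. (?w t * sqrt \<rho> ^ t - ?w t) / (sqrt \<rho> - 1))
        sums ((exp (p * (sqrt \<rho> - 1)) - 1) / (sqrt \<rho> - 1))"
      by (intro sums_divide sums_diff poisson_generating_function p total)
    then have "(\<lambda>t. ?w t * ((sqrt \<rho> ^ t - 1) / (sqrt \<rho> - 1)))
        sums ((exp (p * (sqrt \<rho> - 1)) - 1) / (sqrt \<rho> - 1))"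
      by (simp only: right_diff_distrib times_divide_eq_right mult_1_right)
    moreover have "?w t * ((sqrt \<rho> ^ t - 1) / (sqrt \<rho> - 1)) \<ge> 0" for t
      using rho by (intro mult_nonneg_nonneg divide_nonneg_nonneg) (auto simp: one_le_power)
    ultimately have "(\<Sum>\<^sub>\<infinity>t\<in>{1..}. ?w t * ((sqrt \<rho> ^ t - 1) / (sqrt \<rho> - 1)))
        = (exp (p * (sqrt \<rho> - 1)) - 1) / (sqrt \<rho> - 1)"
      by (intro infsum_drop_zero) auto
    then show ?thesis
      using rho by (simp only: gamma1_def q root powr_half_sqrt)
  qed
  moreover have "gamma2 q \<rho> = sqrt ((\<rho> * p * exp (p * (\<rho> - 1)) - p) / (1 - inverse \<rho>))"
  proof -
    have "(\<lambda>t. (?w t * (real t * \<rho> ^ t) - ?w t * real t) / (1 - inverse \<rho>))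
        sums ((\<rho> * p * exp (p * (\<rho> - 1)) - p) / (1 - inverse \<rho>))"
      by (intro sums_divide sums_diff poisson_weighted_first_moment p mean)
    then have "(\<lambda>t. ?w t * real t * ((\<rho> ^ t - 1) / (1 - inverse \<rho>)))
        sums ((\<rho> * p * exp (p * (\<rho> - 1)) - p) / (1 - inverse \<rho>))"
      by (simp only: right_diff_distrib times_divide_eq_right mult_1_right mult.assoc)
    moreover have "?w t * real t * ((\<rho> ^ t - 1) / (1 - inverse \<rho>)) \<ge> 0" for t
      using rho by (intro mult_nonneg_nonneg divide_nonneg_nonneg)
        (auto simp: one_le_power inverse_le_1_iff)
    ultimately show ?thesis
      unfolding gamma2_def q by (subst infsum_drop_zero) auto
  qed
  moreover have "prob_space.expectation M (\<lambda>\<omega>. real (j \<omega>)) = p"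
    by (rule expectation[OF _ mean]) simp
  moreover have "prob_space.expectation M (\<lambda>\<omega>. real (j \<omega>) ^ 2) = p * (p + 1)"
    by (rule expectation[OF _ poisson_second_moment[OF p]]) simp
  moreover have "prob_space.expectation M (\<lambda>\<omega>. \<rho> ^ j \<omega>) = exp (p * (\<rho> - 1))"
    using rho by (intro expectation[OF _ poisson_generating_function[OF p]]) simp
  moreover have "prob_space.expectation M (\<lambda>\<omega>. real (j \<omega>) * \<rho> ^ j \<omega>)
      = \<rho> * p * exp (p * (\<rho> - 1))"
    using rho by (intro expectation[OF _ poisson_weighted_first_moment[OF p]]) simp
  ultimately show ?thesis
    by blast
qed

end
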